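(* Let $\Gamma$ be a countable discrete sofic group acting by homeomorphisms on a compact metrizable space $X$, and let $\Sigma=\{\sigma_i:\Gamma\to\mathrm{Sym}(d_i)\}_{i\ge 1}$ be a sofic approximation of $\Gamma$. Let $\rho$ be a compatible metric on $X$ with tame growth of covering numbers. Then, for every $1\le p<\infty$, $$\underline{\mathrm{mdim}}_{\Sigma,1}(X,\rho)=\underline{\mathrm{mdim}}_{\Sigma,p}(X,\rho)=\underline{\mathrm{mdim}}_{\Sigma,\infty}(X,\rho)$$ and $$\overline{\mathrm{mdim}}_{\Sigma,1}(X,\rho)=\overline{\mathrm{mdim}}_{\Sigma,p}(X,\rho)=\overline{\mathrm{mdim}}_{\Sigma,\infty}(X,\rho).$$
   Context: For $d\in\mathbb N=\{1,2,\dots\}$, $[d]=\{1,\dots,d\}$ and $\mathrm{Sym}(d)$ is the permutation group of $[d]$. A sofic approximation of a countable group $\Gamma$ is a sequence of maps $\Sigma=\{\sigma_i:\Gamma\to\mathrm{Sym}(d_i)\}_{i=1}^\infty$ such that (1) for all $s,t\in\Gamma$, $\lim_i \frac1{d_i}|\{v\in[d_i]:\sigma_i(s)\sigma_i(t)(v)=\sigma_i(st)(v)\}|=1$; (2) for all distinct $s,t\in\Gamma$, $\lim_i\frac1{d_i}|\{v\in[d_i]:\sigma_i(s)(v)=\sigma_i(t)(v)\}|=0$; (3) $\lim_i d_i=+\infty$. $\Gamma$ is sofic if it has a sofic approximation. For a map $\sigma:\Gamma\to\mathrm{Sym}(d)$ write $\sigma_s=\sigma(s)$. For a pseudometric space $(Y,\rho)$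 and $\varepsilon>0$, a subset $E\subseteq Y$ is $(\rho,\varepsilon)$-spanning if for every $y\in Y$ there is $x\in E$ with $\rho(x,y)<\varepsilon$; $\mathrm S_\varepsilon(Y,\rho)$ is the least cardinality of a $(\rho,\varepsilon)$-spanning subset of $Y$. Conventions: $\mathrm S_\varepsilon(\varnothing,\rho)=0$, $\log 0=-\infty$. For a continuous pseudometric $\rho$ on $X$ and maps $\varphi,\psi:[d]\to X$, put $\rho_p(\varphi,\psi)=\left(\frac1d\sum_{v=1}^d\rho(\varphi(v),\psi(v))^p\right)^{1/p}$ for $1\le p<\infty$ and $\rho_\infty(\varphi,\psi)=\max_{1\le v\le d}\rho(\varphi(v),\psi(v))$. For nonempty finite $F\subseteq\Gamma$, $\delta>0$ and $\sigma:\Gamma\to\mathrm{Sym}(d)$, let $\mathrm{Map}(\rho,F,\delta,\sigma)=\{\varphi:[d]\to X:\ \rho_2(\varphi\circ\sigma_s,s\varphi)<\delta\text{ for every }s\in F\}$, where $(s\varphi)(v)=s\varphi(v)$. A compatible metric on $X$ is a metric inducing the topology of $X$. For a compatible metric $\rho$, $1\le p\le\infty$ and $\varepsilon>0$, define $$h_{\Sigma,p}(\varepsilon,\rho)=\inf_{F}\inf_{\delta>0}\limsup_{i\to\infty}\frac1{d_i}\log\mathrm S_\varepsilon\bigl(\mathrm{Map}(\rho,F,\delta,\sigma_i),\rho_p\bigr),$$ with $F$ ranging over nonempty finite subsets of $\Gamma$ (the value is $-\infty$ if for some $F,\delta$ the sets $\mathrm{Map}(\rho,F,\delta,\sigma_i)$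 are empty for all sufficiently large $i$). Define $$\underline{\mathrm{mdim}}_{\Sigma,p}(X,\rho)=\liminf_{\varepsilon\downarrow0}\frac{h_{\Sigma,p}(\varepsilon,\rho)}{\log(1/\varepsilon)},\qquad \overline{\mathrm{mdim}}_{\Sigma,p}(X,\rho)=\limsup_{\varepsilon\downarrow0}\frac{h_{\Sigma,p}(\varepsilon,\rho)}{\log(1/\varepsilon)},$$ with values in the extended reals. A compact metric space $(X,\rho)$ has tame growth of covering numbers if for every $a>0$, $\lim_{\varepsilon\downarrow0}\varepsilon^a\log\mathrm S_\varepsilon(X,\rho)=0$. *)

theory Defs
  imports
    "HOL-Analysis.Analysis"
    "HOL-Algebra.Sym_Groups"
    "HOL-Algebra.Group_Action"
begin

text \<open>The sequence is indexed from 0 instead of 1; only its tail matters.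
  \<^term>\<open>sym_group n\<close> consists of the permutations of \<^term>\<open>{1..n::nat}\<close>, extended by the
  identity outside that set.\<close>

definition sofic_approximation ::
  "('g, 'z) monoid_scheme \<Rightarrow> (nat \<Rightarrow> nat) \<Rightarrow> (nat \<Rightarrow> 'g \<Rightarrow> nat \<Rightarrow> nat) \<Rightarrow> bool" where
  "sofic_approximation G d \<sigma> \<longleftrightarrow>
     (\<forall>i. d i \<ge> 1) \<and>
     (\<forall>i. \<sigma> i \<in> carrier G \<rightarrow> carrier (sym_group (d i))) \<and>
     (\<forall>s\<in>carrier G. \<forall>t\<in>carrier G.
        (\<lambda>i. real (card {v\<in>{1..d i}. \<sigma> i s (\<sigma> i t v) = \<sigma> i (s \<otimes>\<^bsub>G\<^esub> t) v}) / real (d i))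
          \<longlonglongrightarrow> 1) \<and>
     (\<forall>s\<in>carrier G. \<forall>t\<in>carrier G. s \<noteq> t \<longrightarrow>
        (\<lambda>i. real (card {v\<in>{1..d i}. \<sigma> i s v = \<sigma> i t v}) / real (d i)) \<longlonglongrightarrow> 0) \<and>
     filterlim d at_top sequentially"

definition sofic_group :: "('g, 'z) monoid_scheme \<Rightarrow> bool" where
  "sofic_group G \<longleftrightarrow> (\<exists>d \<sigma>. sofic_approximation G d \<sigma>)"

definition spanning :: "'y set \<Rightarrow> ('y \<Rightarrow> 'y \<Rightarrow> real) \<Rightarrow> real \<Rightarrow> 'y set \<Rightarrow> bool" where
  "spanning Y \<rho> \<epsilon> E \<longleftrightarrow> E \<subseteq> Y \<and> (\<forall>y\<in>Y. \<exists>x\<in>E. \<rho> x y < \<epsilon>)"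

text \<open>The value is \<^term>\<open>\<infinity>::enat\<close> if there is no finite spanning set.\<close>

definition span_num :: "real \<Rightarrow> 'y set \<Rightarrow> ('y \<Rightarrow> 'y \<Rightarrow> real) \<Rightarrow> enat" where
  "span_num \<epsilon> Y \<rho> = (INF E\<in>{E. finite E \<and> spanning Y \<rho> \<epsilon> E}. enat (card E))"

definition log_enat :: "enat \<Rightarrow> ereal" where
  "log_enat n = (case n of enat k \<Rightarrow> if k = 0 then -\<infinity> else ereal (ln (real k)) | \<infinity> \<Rightarrow> \<infinity>)"

definition compatible_metric :: "'x topology \<Rightarrow> ('x \<Rightarrow> 'x \<Rightarrow> real) \<Rightarrow> bool" where
  "compatible_metric X \<rho> \<longleftrightarrow>
     Metric_space (topspace X) \<rho> \<and> Metric_space.mtopology (topspace X) \<rho> = X"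

definition tame_growth :: "'x set \<Rightarrow> ('x \<Rightarrow> 'x \<Rightarrow> real) \<Rightarrow> bool" where
  "tame_growth M \<rho> \<longleftrightarrow>
     (\<forall>a::real. a > 0 \<longrightarrow>
        ((\<lambda>\<epsilon>. ereal (\<epsilon> powr a) * log_enat (span_num \<epsilon> M \<rho>)) \<longlongrightarrow> 0) (at_right 0))"

definition rho_avg ::
  "('x \<Rightarrow> 'x \<Rightarrow> real) \<Rightarrow> nat \<Rightarrow> ereal \<Rightarrow> (nat \<Rightarrow> 'x) \<Rightarrow> (nat \<Rightarrow> 'x) \<Rightarrow> real" where
  "rho_avg \<rho> d p \<phi> \<psi> =
     (if p = \<infinity> then Max ((\<lambda>v. \<rho> (\<phi> v) (\<psi> v)) ` {1..d})
      else ((\<Sum>v=1..d. \<rho> (\<phi> v) (\<psi> v) powr real_of_ereal p) / real d)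
             powr (1 / real_of_ereal p))"

definition Map_space ::
  "'x set \<Rightarrow> ('g \<Rightarrow> 'x \<Rightarrow> 'x) \<Rightarrow> ('x \<Rightarrow> 'x \<Rightarrow> real) \<Rightarrow> 'g set \<Rightarrow> real \<Rightarrow> nat
     \<Rightarrow> ('g \<Rightarrow> nat \<Rightarrow> nat) \<Rightarrow> (nat \<Rightarrow> 'x) set" where
  "Map_space M \<alpha> \<rho> F \<delta> d \<sigma> =
     {\<phi> \<in> {1..d} \<rightarrow>\<^sub>E M. \<forall>s\<in>F. rho_avg \<rho> d 2 (\<phi> \<circ> \<sigma> s) (\<lambda>v. \<alpha> s (\<phi> v)) < \<delta>}"

definition h_eps ::
  "('g, 'z) monoid_scheme \<Rightarrow> 'x set \<Rightarrow> ('g \<Rightarrow> 'x \<Rightarrow> 'x) \<Rightarrow> (nat \<Rightarrow> nat)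
     \<Rightarrow> (nat \<Rightarrow> 'g \<Rightarrow> nat \<Rightarrow> nat) \<Rightarrow> ereal \<Rightarrow> real \<Rightarrow> ('x \<Rightarrow> 'x \<Rightarrow> real) \<Rightarrow> ereal" where
  "h_eps G M \<alpha> d \<sigma> p \<epsilon> \<rho> =
     (INF F\<in>{F. F \<subseteq> carrier G \<and> finite F \<and> F \<noteq> {}}. INF \<delta>\<in>{0<..}.
        limsup (\<lambda>i. log_enat (span_num \<epsilon> (Map_space M \<alpha> \<rho> F \<delta> (d i) (\<sigma> i)) (rho_avg \<rho> (d i) p))
                    / ereal (real (d i))))"

definition lower_mdim ::
  "('g, 'z) monoid_scheme \<Rightarrow> 'x set \<Rightarrow> ('g \<Rightarrow> 'x \<Rightarrow> 'x) \<Rightarrow> (nat \<Rightarrow> nat)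
     \<Rightarrow> (nat \<Rightarrow> 'g \<Rightarrow> nat \<Rightarrow> nat) \<Rightarrow> ereal \<Rightarrow> ('x \<Rightarrow> 'x \<Rightarrow> real) \<Rightarrow> ereal" where
  "lower_mdim G M \<alpha> d \<sigma> p \<rho> =
     Liminf (at_right 0) (\<lambda>\<epsilon>. h_eps G M \<alpha> d \<sigma> p \<epsilon> \<rho> / ereal (ln (1 / \<epsilon>)))"

definition upper_mdim ::
  "('g, 'z) monoid_scheme \<Rightarrow> 'x set \<Rightarrow> ('g \<Rightarrow> 'x \<Rightarrow> 'x) \<Rightarrow> (nat \<Rightarrow> nat)
     \<Rightarrow> (nat \<Rightarrow> 'g \<Rightarrow> nat \<Rightarrow> nat) \<Rightarrow> ereal \<Rightarrow> ('x \<Rightarrow> 'x \<Rightarrow> real) \<Rightarrow> ereal" where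
  "upper_mdim G M \<alpha> d \<sigma> p \<rho> =
     Limsup (at_right 0) (\<lambda>\<epsilon>. h_eps G M \<alpha> d \<sigma> p \<epsilon> \<rho> / ereal (ln (1 / \<epsilon>)))"

end

theory Submission
  imports Defs
begin

text \<open>
  It suffices to compare each finite exponent \<open>p \<ge> 1\<close> with \<open>\<infinity>\<close>. One inequality is immediate from
  \<open>\<rho>\<^sub>p \<le> \<rho>\<^sub>\<infinity>\<close>. For the other, two maps that are close in \<open>\<rho>\<^sub>p\<close> can be far apart only on a small
  proportion of the coordinates, and tame growth makes the correction of those coordinates cheap.

  Let \<open>Y\<close> be a set of maps \<open>[d] \<rightarrow> X\<close>, let \<open>L \<ge> 1\<close>, and let \<open>\<rho>\<^sub>p(\<psi>, \<phi>) < \<epsilon>\<close>. By Markov's inequality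
  the set \<open>A\<close> of coordinates with \<open>\<rho>(\<psi>(v), \<phi>(v)) \<ge> L\<epsilon>\<close> has at most \<open>d/L\<close> elements
  (\<open>card_far_coordinates_le\<close>). So \<open>\<phi>\<close> is determined up to \<open>\<rho>\<^sub>\<infinity>\<close>-distance \<open>L\<epsilon>\<close> by a
  \<open>\<rho>\<^sub>p\<close>-centre \<open>\<psi>\<close>, the set \<open>A\<close>, and on \<open>A\<close> a choice of points in an \<open>\<epsilon>\<close>-net of \<open>X\<close>. With
  \<open>S\<^sub>\<epsilon>\<close> the least size of a spanning set, counting these data gives
  (\<open>span_num_max_le_mult\<close>)
    \<open>S\<^bsub>2L\<epsilon>\<^esub>(Y, \<rho>\<^sub>\<infinity>) \<le> S\<^sub>\<epsilon>(Y, \<rho>\<^sub>p) 2\<^sup>d S\<^sub>\<epsilon>(X, \<rho>)\<^bsup>d/L\<^esup>\<close>.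
  Taking logarithms, dividing by \<open>d\<close> and passing to the limit,
    \<open>h\<^sub>\<infinity>(2L\<epsilon>) \<le> h\<^sub>p(\<epsilon>) + ln 2 + (1/L) ln S\<^sub>\<epsilon>(X, \<rho>)\<close>.

  Now let \<open>2L = \<epsilon>\<^bsup>-a\<^esup>\<close> with \<open>0 < a < 1\<close>. The last term is \<open>2 \<epsilon>\<^sup>a ln S\<^sub>\<epsilon>(X, \<rho>)\<close>, which is bounded by
  tame growth, and the left radius is \<open>\<epsilon>\<^bsup>1-a\<^esup>\<close>. Division by \<open>ln (1/\<epsilon>)\<close> removes the bounded error and
  yields \<open>(1-a) f\<^sub>\<infinity>(\<epsilon>\<^bsup>1-a\<^esup>) \<le> f\<^sub>p(\<epsilon>) + a\<close> for small \<open>\<epsilon>\<close>, where \<open>f(\<epsilon>) = h(\<epsilon>) / ln (1/\<epsilon>)\<close>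
  (\<open>h_eps_max_rescaled_le\<close>). The substitution \<open>\<epsilon> \<mapsto> \<epsilon>\<^bsup>1-a\<^esup>\<close> preserves lower and upper limits at
  \<open>0\<close>, so letting \<open>a \<rightarrow> 0\<close> finishes the proof (\<open>Liminf_Limsup_le_of_rescaling\<close>).
\<close>

section \<open>Spanning numbers\<close>

text \<open>
  A code whose fibres are small bounds the spanning number,
  because one representative from each fibre is a spanning set. The representatives lie in \<open>Y\<close>
  itself, as the definition of a spanning set demands.
\<close>

lemma span_num_le_card_of_code:
  assumes "finite C" and "f ` Y \<subseteq> C"
    and close: "\<And>x y. x \<in> Y \<Longrightarrow> y \<in> Y \<Longrightarrow> f x = f y \<Longrightarrow> \<rho> x y < \<epsilon>"
  shows "span_num \<epsilon> Y \<rho> \<le> enat (card C)"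
proof -
  define E where "E = inv_into Y f ` f ` Y"
  have fin: "finite (f ` Y)"
    using assms(1,2) by (rule finite_subset[rotated])
  have "E \<subseteq> Y"
    unfolding E_def by (auto intro: inv_into_into)
  moreover have "\<exists>x\<in>E. \<rho> x y < \<epsilon>" if "y \<in> Y" for y
  proof
    show "inv_into Y f (f y) \<in> E"
      using that by (auto simp: E_def)
    show "\<rho> (inv_into Y f (f y)) y < \<epsilon>"
      using that by (intro close) (auto intro: inv_into_into f_inv_into_f)
  qed
  ultimately have "spanning Y \<rho> \<epsilon> E"
    by (auto simp: spanning_def)
  moreover have "finite E"
    using fin by (simp add: E_def)
  ultimately have "span_num \<epsilon> Y \<rho> \<le> enat (card E)"
    unfolding span_num_def by (intro INF_lower) auto
  also have "card E \<le> card C"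
    unfolding E_def using card_image_le[OF fin] card_mono[OF assms(1,2)] le_trans by blast
  finally show ?thesis
    by simp
qed

lemma span_num_mono_metric:
  assumes "\<And>x y. x \<in> Y \<Longrightarrow> y \<in> Y \<Longrightarrow> \<rho> x y \<le> \<rho>' x y"
  shows "span_num \<epsilon> Y \<rho> \<le> span_num \<epsilon> Y \<rho>'"
  unfolding span_num_def
proof (rule INF_superset_mono)
  show "{E. finite E \<and> spanning Y \<rho>' \<epsilon> E} \<subseteq> {E. finite E \<and> spanning Y \<rho> \<epsilon> E}"
    using assms unfolding spanning_def by (smt (verit, best) Collect_mono subsetD)
qed simp

lemma span_num_attained:
  assumes "span_num \<epsilon> Y \<rho> = enat n"
  obtains E where "finite E" "spanning Y \<rho> \<epsilon> E" "card E = n"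
proof -
  let ?S = "(\<lambda>E. enat (card E)) ` {E. finite E \<and> spanning Y \<rho> \<epsilon> E}"
  have "?S \<noteq> {}"
  proof
    assume "?S = {}"
    then have "span_num \<epsilon> Y \<rho> = \<infinity>"
      by (simp only: span_num_def Inf_empty top_enat_def)
    then show False
      using assms by simp
  qed
  then have "Inf ?S \<in> ?S"
    unfolding Inf_enat_def by (metis (mono_tags, lifting) LeastI all_not_in_conv)
  then show ?thesis
    using assms that unfolding span_num_def by auto
qed

section \<open>Averaged and maximal distances\<close>

lemma rho_avg_le_max:
  assumes "1 \<le> d" and "1 \<le> p"
    and nonneg: "\<And>v. v \<in> {1..d} \<Longrightarrow> 0 \<le> \<rho> (\<phi> v) (\<psi> v)"
  shows "rho_avg \<rho> d (ereal p) \<phi> \<psi> \<le> rho_avg \<rho> d \<infinity> \<phi> \<psi>"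
proof -
  define m where "m = Max ((\<lambda>v. \<rho> (\<phi> v) (\<psi> v)) ` {1..d})"
  have le: "\<rho> (\<phi> v) (\<psi> v) \<le> m" if "v \<in> {1..d}" for v
    unfolding m_def using that by (intro Max_ge) auto
  have "0 \<le> m"
    using le[of 1] nonneg[of 1] assms(1) by auto
  have "(\<Sum>v=1..d. \<rho> (\<phi> v) (\<psi> v) powr p) \<le> (\<Sum>v=1..d. m powr p)"
    using assms(2) nonneg le by (intro sum_mono powr_mono2) auto
  then have "(\<Sum>v=1..d. \<rho> (\<phi> v) (\<psi> v) powr p) / real d \<le> m powr p"
    using assms(1) by (simp add: field_simps)
  then have "((\<Sum>v=1..d. \<rho> (\<phi> v) (\<psi> v) powr p) / real d) powr (1 / p) \<le> (m powr p) powr (1 / p)"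
    using assms(2) by (intro powr_mono2) (auto intro!: sum_nonneg divide_nonneg_nonneg)
  also have "\<dots> = m"
    using \<open>0 \<le> m\<close> assms(2) by (simp add: powr_powr)
  finally show ?thesis
    by (simp add: rho_avg_def m_def)
qed

text \<open>
  Markov's inequality for \<open>\<rho>\<^sup>p\<close> bounds the number of far coordinates by \<open>d / L\<^sup>p\<close>. The weaker bound
  \<open>d / L\<close> suffices and lets one choice of \<open>L\<close> serve all exponents.
\<close>

lemma card_far_coordinates_le:
  assumes "1 \<le> d" and "1 \<le> p" and "1 \<le> L" and "0 < \<epsilon>"
    and avg: "rho_avg \<rho> d (ereal p) \<phi> \<psi> < \<epsilon>"
  shows "real (card {v\<in>{1..d}. L * \<epsilon> \<le> \<rho> (\<phi> v) (\<psi> v)}) \<le> real d / L"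
proof -
  define A where "A = {v\<in>{1..d}. L * \<epsilon> \<le> \<rho> (\<phi> v) (\<psi> v)}"
  define S where "S = (\<Sum>v=1..d. \<rho> (\<phi> v) (\<psi> v) powr p)"
  have "S \<ge> 0"
    unfolding S_def by (intro sum_nonneg) auto
  have "(S / real d) powr (1 / p) < \<epsilon>"
    using avg by (simp add: rho_avg_def S_def)
  then have "((S / real d) powr (1 / p)) powr p < \<epsilon> powr p"
    using assms(2) by (intro powr_less_mono2) auto
  then have S_less: "S < real d * \<epsilon> powr p"
    using assms(1,2) \<open>S \<ge> 0\<close> by (simp add: powr_powr field_simps)
  have "real (card A) * (L * \<epsilon> powr p) \<le> real (card A) * (L * \<epsilon>) powr p"
  proof -
    have "L powr 1 \<le> L powr p"
      using assms(2,3) by (intro powr_mono) auto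
    then show ?thesis
      using assms(3,4) by (intro mult_left_mono) (auto simp: powr_mult)
  qed
  also have "\<dots> = (\<Sum>v\<in>A. (L * \<epsilon>) powr p)"
    by simp
  also have "\<dots> \<le> (\<Sum>v\<in>A. \<rho> (\<phi> v) (\<psi> v) powr p)"
    using assms(2-4) by (intro sum_mono powr_mono2) (auto simp: A_def)
  also have "\<dots> \<le> S"
    unfolding S_def by (intro sum_mono2) (auto simp: A_def)
  finally have "(real (card A) * L) * \<epsilon> powr p < real d * \<epsilon> powr p"
    using S_less by (simp add: mult.assoc)
  then show ?thesis
    using assms(3,4) by (simp add: A_def field_simps)
qed

section \<open>Coding maps by centres and corrections\<close>

text \<open>
  Such a pair records the positions of at most \<open>k\<close> coordinates and a net point for each of them:
  there are at most \<open>2\<^sup>d\<close> sets of positions and \<open>|N|\<^sup>k\<close> values on each.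
\<close>

lemma card_partial_functions_le:
  assumes "finite N" and "1 \<le> card N"
  shows "finite (SIGMA A:{A. A \<subseteq> {1..d::nat} \<and> card A \<le> k}. A \<rightarrow>\<^sub>E N)" (is "finite ?K")
    and "card (SIGMA A:{A. A \<subseteq> {1..d::nat} \<and> card A \<le> k}. A \<rightarrow>\<^sub>E N) \<le> 2 ^ d * card N ^ k"
proof -
  let ?P = "{A. A \<subseteq> {1..d::nat} \<and> card A \<le> k}"
  have finP: "finite ?P"
    by (rule finite_subset[of _ "Pow {1..d}"]) auto
  have finA: "finite A" if "A \<in> ?P" for A
    using that by (intro finite_subset[of A "{1..d}"]) auto
  have fin_funs: "finite (A \<rightarrow>\<^sub>E N)" if "A \<in> ?P" for A
    using finA[OF that] assms(1) by (rule finite_PiE)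
  show "finite ?K"
    using finP fin_funs by (rule finite_SigmaI)
  have "card ?K = (\<Sum>A\<in>?P. card (A \<rightarrow>\<^sub>E N))"
    using finP fin_funs by (intro card_SigmaI) blast+
  also have "\<dots> = (\<Sum>A\<in>?P. card N ^ card A)"
    by (intro sum.cong refl) (simp only: card_PiE[OF finA] prod_constant)
  also have "\<dots> \<le> (\<Sum>A\<in>?P. card N ^ k)"
    using assms(2) by (intro sum_mono power_increasing) auto
  also have "\<dots> = card ?P * card N ^ k"
    by simp
  also have "card ?P \<le> card (Pow {1..d})"
    by (intro card_mono) auto
  also have "\<dots> = 2 ^ d"
    by (simp add: card_Pow)
  finally show "card ?K \<le> 2 ^ d * card N ^ k"
    by simp
qed

text \<open>
  The code of \<open>\<phi>\<close> consists of a \<open>\<rho>\<^sub>p\<close>-centre for \<open>\<phi>\<close>, the set where \<open>\<phi>\<close> is far from that centre, and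
  net points near \<open>\<phi>\<close> on that set. These data locate every coordinate of \<open>\<phi>\<close> to within \<open>L\<epsilon>\<close>, so
  two maps with the same code differ by less than \<open>2L\<epsilon>\<close>. The factor \<open>2\<close> arises because the map
  described by the code need not lie in \<open>Y\<close>.
\<close>

lemma span_num_max_le_mult:
  assumes metric: "Metric_space M \<rho>"
    and "1 \<le> d" and "1 \<le> p" and L: "1 \<le> L" and "0 < \<epsilon>"
    and Y: "Y \<subseteq> {1..d} \<rightarrow>\<^sub>E M"
    and E: "finite E" "spanning Y (rho_avg \<rho> d (ereal p)) \<epsilon> E"
    and N: "finite N" "spanning M \<rho> \<epsilon> N" "1 \<le> card N"
  shows "span_num (2 * L * \<epsilon>) Y (rho_avg \<rho> d \<infinity>)
           \<le> enat (card E * (2 ^ d * card N ^ nat \<lfloor>real d / L\<rfloor>))"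
proof -
  define k where "k = nat \<lfloor>real d / L\<rfloor>"
  define K where "K = (SIGMA A:{A. A \<subseteq> {1..d} \<and> card A \<le> k}. A \<rightarrow>\<^sub>E N)"
  have inM: "\<phi> v \<in> M" if "\<phi> \<in> Y" "v \<in> {1..d}" for \<phi> v
    using that Y by (auto dest!: subsetD PiE_mem)
  have "\<exists>\<psi>. \<forall>\<phi>\<in>Y. \<psi> \<phi> \<in> E \<and> rho_avg \<rho> d (ereal p) (\<psi> \<phi>) \<phi> < \<epsilon>"
    by (rule bchoice) (use E(2) in \<open>auto simp: spanning_def\<close>)
  then obtain centre where centre: "\<And>\<phi>. \<phi> \<in> Y \<Longrightarrow> centre \<phi> \<in> E"
      "\<And>\<phi>. \<phi> \<in> Y \<Longrightarrow> rho_avg \<rho> d (ereal p) (centre \<phi>) \<phi> < \<epsilon>"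
    by blast
  have centre_in: "centre \<phi> \<in> Y" if "\<phi> \<in> Y" for \<phi>
    using E(2) centre(1)[OF that] unfolding spanning_def by blast
  have "\<exists>n. \<forall>x\<in>M. n x \<in> N \<and> \<rho> (n x) x < \<epsilon>"
    by (rule bchoice) (use N(2) in \<open>auto simp: spanning_def\<close>)
  then obtain net where net: "\<And>x. x \<in> M \<Longrightarrow> net x \<in> N" "\<And>x. x \<in> M \<Longrightarrow> \<rho> (net x) x < \<epsilon>"
    by blast
  have net_in: "net x \<in> M" if "x \<in> M" for x
    using N(2) net(1)[OF that] unfolding spanning_def by blast
  define far where "far \<phi> = {v\<in>{1..d}. L * \<epsilon> \<le> \<rho> (centre \<phi> v) (\<phi> v)}" for \<phi>
  define code where "code \<phi> = (centre \<phi>, far \<phi>, restrict (net \<circ> \<phi>) (far \<phi>))" for \<phi>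
  have "code ` Y \<subseteq> E \<times> K"
  proof (rule image_subsetI)
    fix \<phi> assume \<phi>: "\<phi> \<in> Y"
    have "real (card (far \<phi>)) \<le> real d / L"
      unfolding far_def by (rule card_far_coordinates_le[OF assms(2,3,4,5) centre(2)[OF \<phi>]])
    then have "card (far \<phi>) \<le> k"
      by (simp add: k_def le_nat_floor)
    moreover have "far \<phi> \<subseteq> {1..d}"
      by (auto simp: far_def)
    moreover have "restrict (net \<circ> \<phi>) (far \<phi>) \<in> far \<phi> \<rightarrow>\<^sub>E N"
      using net(1) inM[OF \<phi>] by (auto simp: far_def)
    ultimately show "code \<phi> \<in> E \<times> K"
      using centre(1)[OF \<phi>] by (simp add: code_def K_def)
  qed
  moreover have "rho_avg \<rho> d \<infinity> \<phi> \<psi> < 2 * L * \<epsilon>"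
    if \<phi>: "\<phi> \<in> Y" and \<psi>: "\<psi> \<in> Y" and eq: "code \<phi> = code \<psi>" for \<phi> \<psi>
  proof -
    have "\<rho> (\<phi> v) (\<psi> v) < 2 * L * \<epsilon>" if v: "v \<in> {1..d}" for v
    proof (cases "v \<in> far \<phi>")
      case True
      have "far \<phi> = far \<psi>"
        and "restrict (net \<circ> \<phi>) (far \<phi>) = restrict (net \<circ> \<psi>) (far \<psi>)"
        by (rule eq[unfolded code_def prod.inject, THEN conjunct2, THEN conjunct1],
            rule eq[unfolded code_def prod.inject, THEN conjunct2, THEN conjunct2])
      then have "restrict (net \<circ> \<phi>) (far \<phi>) v = restrict (net \<circ> \<psi>) (far \<phi>) v"
        by simp
      then have same: "net (\<phi> v) = net (\<psi> v)"
        using True by simp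
      have "\<rho> (\<phi> v) (\<psi> v) \<le> \<rho> (net (\<phi> v)) (\<phi> v) + \<rho> (net (\<phi> v)) (\<psi> v)"
        by (rule Metric_space.triangle''[OF metric inM[OF \<phi> v] net_in[OF inM[OF \<phi> v]]
              inM[OF \<psi> v]])
      also have "\<dots> < 2 * \<epsilon>"
        using net(2)[OF inM[OF \<phi> v]] net(2)[OF inM[OF \<psi> v]] same by simp
      also have "\<dots> \<le> 2 * L * \<epsilon>"
        using L \<open>0 < \<epsilon>\<close> by simp
      finally show ?thesis .
    next
      case False
      have same: "centre \<phi> = centre \<psi>" "far \<phi> = far \<psi>"
        by (rule eq[unfolded code_def prod.inject, THEN conjunct1],
            rule eq[unfolded code_def prod.inject, THEN conjunct2, THEN conjunct1])
      have near: "\<rho> (centre \<phi> v) (\<phi> v) < L * \<epsilon>" "\<rho> (centre \<psi> v) (\<psi> v) < L * \<epsilon>"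
        using False False[unfolded same(2)] v by (simp_all add: far_def)
      have "\<rho> (\<phi> v) (\<psi> v) \<le> \<rho> (centre \<phi> v) (\<phi> v) + \<rho> (centre \<phi> v) (\<psi> v)"
        by (rule Metric_space.triangle''[OF metric inM[OF \<phi> v]
              inM[OF centre_in[OF \<phi>] v] inM[OF \<psi> v]])
      then show ?thesis
        using near unfolding same(1) by simp
    qed
    then show ?thesis
      using assms(2) by (simp add: rho_avg_def)
  qed
  moreover have "finite (E \<times> K)"
    unfolding K_def by (intro finite_cartesian_product E(1) card_partial_functions_le(1)[OF N(1,3)])
  ultimately have "span_num (2 * L * \<epsilon>) Y (rho_avg \<rho> d \<infinity>) \<le> enat (card (E \<times> K))"
    by (intro span_num_le_card_of_code[where f = code])
  also have "card (E \<times> K) \<le> card E * (2 ^ d * card N ^ k)"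
    using card_partial_functions_le(2)[OF N(1,3), of d k]
    by (simp add: card_cartesian_product K_def)
  finally show ?thesis
    by (simp add: k_def)
qed

section \<open>Comparison of the entropies at a fixed scale\<close>

lemma log_enat_mono: "m \<le> n \<Longrightarrow> log_enat m \<le> log_enat n"
  by (cases m; cases n) (auto simp: log_enat_def)

lemma log_enat_mult:
  assumes "0 < m"
  shows "log_enat (enat (n * m)) = log_enat (enat n) + ereal (ln (real m))"
  using assms by (auto simp: log_enat_def ln_mult)

lemma log_span_num_max_le:
  assumes metric: "Metric_space M \<rho>"
    and d: "1 \<le> d" and p: "1 \<le> p" and L: "1 \<le> L" and \<epsilon>: "0 < \<epsilon>"
    and Y: "Y \<subseteq> {1..d} \<rightarrow>\<^sub>E M"
    and N: "span_num \<epsilon> M \<rho> = enat n" "1 \<le> n"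
  shows "log_enat (span_num (2 * L * \<epsilon>) Y (rho_avg \<rho> d \<infinity>)) / ereal (real d)
           \<le> log_enat (span_num \<epsilon> Y (rho_avg \<rho> d (ereal p))) / ereal (real d)
              + ereal (ln 2 + ln (real n) / L)"
proof (cases "span_num \<epsilon> Y (rho_avg \<rho> d (ereal p))")
  case infinity
  then show ?thesis
    using d by (simp add: log_enat_def)
next
  case (enat m)
  obtain E where E: "finite E" "spanning Y (rho_avg \<rho> d (ereal p)) \<epsilon> E" "card E = m"
    using span_num_attained[OF enat] .
  obtain net where net: "finite net" "spanning M \<rho> \<epsilon> net" "card net = n"
    using span_num_attained[OF N(1)] .
  define k where "k = nat \<lfloor>real d / L\<rfloor>"
  have "span_num (2 * L * \<epsilon>) Y (rho_avg \<rho> d \<infinity>) \<le> enat (m * (2 ^ d * n ^ k))"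
    unfolding k_def
    using span_num_max_le_mult[OF metric d p L \<epsilon> Y E(1,2) net(1,2)] N(2) E(3) net(3) by simp
  then have "log_enat (span_num (2 * L * \<epsilon>) Y (rho_avg \<rho> d \<infinity>))
      \<le> log_enat (enat (m * (2 ^ d * n ^ k)))"
    by (rule log_enat_mono)
  also have "\<dots> = log_enat (enat m) + ereal (ln (real (2 ^ d * n ^ k)))"
    using N(2) by (intro log_enat_mult) auto
  also have "ln (real (2 ^ d * n ^ k)) \<le> real d * (ln 2 + ln (real n) / L)"
  proof -
    have "real k \<le> real d / L"
      using L by (simp add: k_def)
    then have "real k * ln (real n) \<le> real d / L * ln (real n)"
      using N(2) by (intro mult_right_mono) auto
    then show ?thesis
      using N(2) by (simp add: ln_mult ln_realpow algebra_simps)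
  qed
  finally have le: "log_enat (span_num (2 * L * \<epsilon>) Y (rho_avg \<rho> d \<infinity>))
      \<le> log_enat (enat m) + ereal (real d * (ln 2 + ln (real n) / L))"
    by (simp add: add_left_mono)
  have "log_enat (span_num (2 * L * \<epsilon>) Y (rho_avg \<rho> d \<infinity>)) / ereal (real d)
      \<le> (log_enat (enat m) + ereal (real d * (ln 2 + ln (real n) / L))) / ereal (real d)"
    using d by (intro ereal_divide_right_mono[OF le]) auto
  also have "\<dots> = log_enat (enat m) / ereal (real d) + ereal (ln 2 + ln (real n) / L)"
    using d by (auto simp: log_enat_def field_simps)
  finally show ?thesis
    using enat by simp
qed

lemma h_eps_mono_exponent:
  assumes "\<And>i. 1 \<le> d i" and "1 \<le> p" and "Metric_space M \<rho>"
  shows "h_eps G M \<alpha> d \<sigma> (ereal p) \<epsilon> \<rho> \<le> h_eps G M \<alpha> d \<sigma> \<infinity> \<epsilon> \<rho>"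
  unfolding h_eps_def
proof (intro INF_mono' Limsup_mono always_eventually allI ereal_divide_right_mono log_enat_mono
    span_num_mono_metric rho_avg_le_max)
  show "0 < ereal (real (d i))" for i
    using assms(1)[of i] by simp
qed (use assms in \<open>auto simp: Metric_space.nonneg\<close>)

text \<open>
  The error term depends neither on \<open>F\<close>, \<open>\<delta>\<close> nor on the index of the sofic approximation, so it survives
  the upper limit and both infima.
\<close>

lemma h_eps_max_le:
  assumes metric: "Metric_space M \<rho>"
    and d: "\<And>i. 1 \<le> d i" and p: "1 \<le> p" and L: "1 \<le> L" and \<epsilon>: "0 < \<epsilon>"
    and N: "span_num \<epsilon> M \<rho> = enat n" "1 \<le> n"
  shows "h_eps G M \<alpha> d \<sigma> \<infinity> (2 * L * \<epsilon>) \<rho>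
           \<le> h_eps G M \<alpha> d \<sigma> (ereal p) \<epsilon> \<rho> + ereal (ln 2 + ln (real n) / L)"
proof -
  define b where "b = ln 2 + ln (real n) / L"
  let ?Y = "\<lambda>F \<delta> i. Map_space M \<alpha> \<rho> F \<delta> (d i) (\<sigma> i)"
  let ?u = "\<lambda>q \<eta> F \<delta> i. log_enat (span_num \<eta> (?Y F \<delta> i) (rho_avg \<rho> (d i) q)) / ereal (real (d i))"
  have limsup_le: "limsup (?u \<infinity> (2 * L * \<epsilon>) F \<delta>) \<le> limsup (?u (ereal p) \<epsilon> F \<delta>) + ereal b" for F \<delta>
  proof -
    have "?u \<infinity> (2 * L * \<epsilon>) F \<delta> i \<le> ?u (ereal p) \<epsilon> F \<delta> i + ereal b" for i
      unfolding b_def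
      by (rule log_span_num_max_le[OF metric d p L \<epsilon> _ N]) (auto simp: Map_space_def)
    then have "limsup (?u \<infinity> (2 * L * \<epsilon>) F \<delta>) \<le> limsup (\<lambda>i. ?u (ereal p) \<epsilon> F \<delta> i + ereal b)"
      by (intro Limsup_mono) simp
    also have "\<dots> = limsup (?u (ereal p) \<epsilon> F \<delta>) + ereal b"
      by (rule Limsup_add_ereal_right) auto
    finally show ?thesis .
  qed
  have "h_eps G M \<alpha> d \<sigma> \<infinity> (2 * L * \<epsilon>) \<rho> - ereal b \<le> h_eps G M \<alpha> d \<sigma> (ereal p) \<epsilon> \<rho>"
    unfolding h_eps_def[of _ _ _ _ _ "ereal p"]
  proof (intro INF_greatest)
    fix F \<delta> assume "F \<in> {F. F \<subseteq> carrier G \<and> finite F \<and> F \<noteq> {}}" "\<delta> \<in> {0::real<..}"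
    then have "h_eps G M \<alpha> d \<sigma> \<infinity> (2 * L * \<epsilon>) \<rho> \<le> limsup (?u \<infinity> (2 * L * \<epsilon>) F \<delta>)"
      unfolding h_eps_def by (intro INF_lower2[of F] INF_lower2[of \<delta>]) auto
    also note limsup_le
    finally show "h_eps G M \<alpha> d \<sigma> \<infinity> (2 * L * \<epsilon>) \<rho> - ereal b \<le> limsup (?u (ereal p) \<epsilon> F \<delta>)"
      by (simp add: ereal_minus_le_iff add.commute)
  qed
  then show ?thesis
    by (simp add: ereal_minus_le_iff b_def add.commute)
qed

section \<open>Power substitutions in limits at zero\<close>

lemma filtermap_powr_at_right_0:
  fixes r :: real
  assumes "0 < r"
  shows "filtermap (\<lambda>x. x powr r) (at_right 0) = at_right 0"
proof (rule filtermap_fun_inverse[where g = "\<lambda>x. x powr (1 / r)"])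
  have *: "filterlim (\<lambda>x. x powr s) (at_right 0) (at_right (0::real))" if "0 < s" for s :: real
  proof (intro tendsto_imp_filterlim_at_right)
    have "((\<lambda>x. x powr s) \<longlongrightarrow> 0 powr s) (at_right (0::real))"
      using that by (intro tendsto_powr2) (auto simp: eventually_at_right_less eventually_at_filter intro!: tendsto_intros)
    then show "((\<lambda>x. x powr s) \<longlongrightarrow> 0) (at_right (0::real))"
      by simp
    show "\<forall>\<^sub>F x in at_right 0. 0 < x powr s"
      by (auto simp: eventually_at_filter)
  qed
  show "filterlim (\<lambda>x. x powr r) (at_right 0) (at_right 0)"
    using assms by (rule *)
  show "filterlim (\<lambda>x. x powr (1 / r)) (at_right 0) (at_right (0::real))"
    using assms by (intro *) auto
  show "\<forall>\<^sub>F x in at_right (0::real). (x powr (1 / r)) powr r = x"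
    using assms by (auto simp: eventually_at_filter powr_powr)
qed

lemma Liminf_powr_at_right_0:
  fixes f :: "real \<Rightarrow> ereal"
  assumes "0 < r"
  shows "Liminf (at_right 0) (\<lambda>x. f (x powr r)) = Liminf (at_right 0) f"
proof -
  have "C \<le> Liminf (at_right 0) (\<lambda>x. f (x powr r)) \<longleftrightarrow> C \<le> Liminf (at_right 0) f" for C
    unfolding le_Liminf_iff
    by (subst (2) filtermap_powr_at_right_0[OF assms, symmetric]) (simp add: eventually_filtermap)
  then show ?thesis
    by (meson antisym order_refl)
qed

lemma Limsup_powr_at_right_0:
  fixes f :: "real \<Rightarrow> ereal"
  assumes "0 < r"
  shows "Limsup (at_right 0) (\<lambda>x. f (x powr r)) = Limsup (at_right 0) f"
proof -
  have "Limsup (at_right 0) (\<lambda>x. f (x powr r)) \<le> C \<longleftrightarrow> Limsup (at_right 0) f \<le> C" for C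
    unfolding Limsup_le_iff
    by (subst (2) filtermap_powr_at_right_0[OF assms, symmetric]) (simp add: eventually_filtermap)
  then show ?thesis
    by (meson antisym order_refl)
qed

text \<open>
  For finite \<open>x\<close> and \<open>y\<close> let \<open>a\<close> tend to \<open>0\<close>; for infinite ones \<open>a = 1/2\<close> already decides.
\<close>

lemma ereal_le_of_contractions:
  fixes x y :: ereal
  assumes "\<And>a::real. 0 < a \<Longrightarrow> a < 1 \<Longrightarrow> ereal (1 - a) * x \<le> y + ereal a"
  shows "x \<le> y"
proof (cases x)
  case (real r)
  note x = this
  show ?thesis
  proof (cases y)
    case y: (real s)
    have "\<forall>\<^sub>F a in at_right (0::real). (1 - a) * r \<le> s + a"
      using eventually_at_right_real[of 0 "1::real"]
    proof (rule eventually_mono)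
      show "(1 - a) * r \<le> s + a" if "a \<in> {0<..<1}" for a
        using assms[of a] that x y by simp
    qed simp
    moreover have "((\<lambda>a::real. (1 - a) * r) \<longlongrightarrow> (1 - 0) * r) (at_right 0)"
      "((\<lambda>a::real. s + a) \<longlongrightarrow> s + 0) (at_right 0)"
      by (intro tendsto_intros)+
    ultimately have "(1 - 0) * r \<le> s + 0"
      by (intro tendsto_le[OF trivial_limit_at_right_real]) auto
    then show ?thesis
      using x y by simp
  next
    case PInf
    then show ?thesis by simp
  next
    case MInf
    then show ?thesis using assms[of "1/2"] x by simp
  qed
next
  case PInf
  then show ?thesis using assms[of "1/2"] by (cases y) auto
next
  case MInf
  then show ?thesis by simp
qed

lemma Liminf_Limsup_le_of_rescaling:
  fixes f g :: "real \<Rightarrow> ereal"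
  assumes "\<And>a. 0 < a \<Longrightarrow> a < 1 \<Longrightarrow>
    \<forall>\<^sub>F \<epsilon> in at_right 0. ereal (1 - a) * f (\<epsilon> powr (1 - a)) \<le> g \<epsilon> + ereal a"
  shows "Liminf (at_right 0) f \<le> Liminf (at_right 0) g"
    and "Limsup (at_right 0) f \<le> Limsup (at_right 0) g"
proof -
  have nontriv: "at_right (0::real) \<noteq> bot"
    by simp
  show "Liminf (at_right 0) f \<le> Liminf (at_right 0) g"
  proof (rule ereal_le_of_contractions)
    fix a :: real assume a: "0 < a" "a < 1"
    have "ereal (1 - a) * Liminf (at_right 0) f
        = Liminf (at_right 0) (\<lambda>\<epsilon>. ereal (1 - a) * f \<epsilon>)"
      using a by (subst Liminf_ereal_mult_left[OF nontriv]) auto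
    also have "\<dots> = Liminf (at_right 0) (\<lambda>\<epsilon>. ereal (1 - a) * f (\<epsilon> powr (1 - a)))"
      using a by (intro Liminf_powr_at_right_0[symmetric]) auto
    also have "\<dots> \<le> Liminf (at_right 0) (\<lambda>\<epsilon>. g \<epsilon> + ereal a)"
      by (rule Liminf_mono[OF assms[OF a]])
    also have "\<dots> = Liminf (at_right 0) g + ereal a"
      by (rule Liminf_add_ereal_right[OF nontriv]) simp
    finally show "ereal (1 - a) * Liminf (at_right 0) f \<le> Liminf (at_right 0) g + ereal a" .
  qed
  show "Limsup (at_right 0) f \<le> Limsup (at_right 0) g"
  proof (rule ereal_le_of_contractions)
    fix a :: real assume a: "0 < a" "a < 1"
    have "ereal (1 - a) * Limsup (at_right 0) f
        = Limsup (at_right 0) (\<lambda>\<epsilon>. ereal (1 - a) * f \<epsilon>)"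
      using a by (subst Limsup_ereal_mult_left[OF nontriv]) auto
    also have "\<dots> = Limsup (at_right 0) (\<lambda>\<epsilon>. ereal (1 - a) * f (\<epsilon> powr (1 - a)))"
      using a by (intro Limsup_powr_at_right_0[symmetric]) auto
    also have "\<dots> \<le> Limsup (at_right 0) (\<lambda>\<epsilon>. g \<epsilon> + ereal a)"
      by (rule Limsup_mono[OF assms[OF a]])
    also have "\<dots> = Limsup (at_right 0) g + ereal a"
      by (rule Limsup_add_ereal_right[OF nontriv]) simp
    finally show "ereal (1 - a) * Limsup (at_right 0) f \<le> Limsup (at_right 0) g + ereal a" .
  qed
qed

section \<open>Metric mean dimensions\<close>

text \<open>
  The choice \<open>2L = \<epsilon>\<^bsup>-a\<^esup>\<close> turns the radius \<open>2L\<epsilon>\<close> into a pure power of \<open>\<epsilon>\<close>, so that its logarithm is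
  exactly \<open>1 - a\<close> times that of \<open>\<epsilon>\<close>, and leaves the error \<open>ln 2 + 2 \<epsilon>\<^sup>a ln S\<^sub>\<epsilon>(M, \<rho>)\<close>, which tame growth
  keeps below \<open>ln 2 + 2\<close> and hence below \<open>a ln (1/\<epsilon>)\<close> for small \<open>\<epsilon>\<close>.
\<close>

lemma h_eps_max_rescaled_le:
  fixes G :: "('g, 'z) monoid_scheme" and \<alpha> :: "'g \<Rightarrow> 'x \<Rightarrow> 'x"
    and d :: "nat \<Rightarrow> nat" and \<sigma> :: "nat \<Rightarrow> 'g \<Rightarrow> nat \<Rightarrow> nat"
  assumes metric: "Metric_space M \<rho>"
    and d: "\<And>i. 1 \<le> d i" and p: "1 \<le> p"
    and tame: "tame_growth M \<rho>"
    and a: "0 < a" "a < 1"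
  defines "f \<equiv> \<lambda>q \<epsilon>. h_eps G M \<alpha> d \<sigma> q \<epsilon> \<rho> / ereal (ln (1 / \<epsilon>))"
  shows "\<forall>\<^sub>F \<epsilon> in at_right 0.
    ereal (1 - a) * f \<infinity> (\<epsilon> powr (1 - a)) \<le> f (ereal p) \<epsilon> + ereal a"
proof -
  have tame_a: "((\<lambda>\<epsilon>. ereal (\<epsilon> powr a) * log_enat (span_num \<epsilon> M \<rho>)) \<longlongrightarrow> 0) (at_right 0)"
    using tame a(1) unfolding tame_growth_def by blast
  have ev1: "\<forall>\<^sub>F \<epsilon> in at_right 0. ereal (\<epsilon> powr a) * log_enat (span_num \<epsilon> M \<rho>) < ereal 1"
    using order_tendstoD(2)[OF tame_a, of "ereal 1"] by simp
  \<comment> \<open>Any lower bound will do: it excludes the value \<open>-\<infinity>\<close>, that is, an empty \<open>M\<close>.\<close>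
  have ev2: "\<forall>\<^sub>F \<epsilon> in at_right 0. ereal (-1) < ereal (\<epsilon> powr a) * log_enat (span_num \<epsilon> M \<rho>)"
    using order_tendstoD(1)[OF tame_a, of "ereal (-1)"] by simp
  \<comment> \<open>Below the first bound \<open>L \<ge> 1\<close>; below the second \<open>ln 2 + 2 < a ln (1/\<epsilon>)\<close>.\<close>
  define \<epsilon>\<^sub>0 where "\<epsilon>\<^sub>0 = min ((1/2) powr (1 / a)) (exp (- (ln 2 + 2) / a))"
  have "0 < \<epsilon>\<^sub>0"
    by (simp add: \<epsilon>\<^sub>0_def)
  then have ev3: "\<forall>\<^sub>F \<epsilon> in at_right 0. \<epsilon> \<in> {0<..<\<epsilon>\<^sub>0}"
    by (rule eventually_at_right_real)
  show ?thesis
    using ev1 ev2 ev3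
  proof eventually_elim
    case (elim \<epsilon>)
    have \<epsilon>: "0 < \<epsilon>" "\<epsilon> < \<epsilon>\<^sub>0"
      using elim(3) by auto
    obtain n where n: "span_num \<epsilon> M \<rho> = enat n" "1 \<le> n" "\<epsilon> powr a * ln (real n) < 1"
      using elim(1,2) \<epsilon>(1)
      by (cases "span_num \<epsilon> M \<rho>") (auto simp: log_enat_def split: if_splits)
    define L where "L = \<epsilon> powr (- a) / 2"
    have "\<epsilon> powr a < ((1/2) powr (1 / a)) powr a"
      using \<epsilon> a by (intro powr_less_mono2) (auto simp: \<epsilon>\<^sub>0_def)
    also have "\<dots> = 1 / 2"
      using a by (simp add: powr_powr)
    finally have L: "1 \<le> L"
      using \<epsilon>(1) by (simp add: L_def powr_minus field_simps)
    have radius: "2 * L * \<epsilon> = \<epsilon> powr (1 - a)"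
      using \<epsilon>(1) by (simp add: L_def powr_minus powr_diff field_simps)
    have "ln \<epsilon> < ln (exp (- (ln 2 + 2) / a))"
      using \<epsilon> by (subst ln_less_cancel_iff) (auto simp: \<epsilon>\<^sub>0_def)
    then have ln_large: "ln 2 + 2 < a * ln (1 / \<epsilon>)"
      using a \<epsilon>(1) by (simp add: ln_div field_simps)
    then have "0 < a * ln (1 / \<epsilon>)"
      using ln_ge_zero[of "2::real"] by linarith
    then have pos: "0 < ln (1 / \<epsilon>)"
      using a by (simp add: zero_less_mult_iff)
    have "ln (real n) / L = 2 * (\<epsilon> powr a * ln (real n))"
      using \<epsilon>(1) by (simp add: L_def powr_minus field_simps)
    then have ln_bound: "ln 2 + ln (real n) / L \<le> a * ln (1 / \<epsilon>)"
      using n(3) ln_large by simp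
    have "h_eps G M \<alpha> d \<sigma> \<infinity> (\<epsilon> powr (1 - a)) \<rho>
        \<le> h_eps G M \<alpha> d \<sigma> (ereal p) \<epsilon> \<rho> + ereal (ln 2 + ln (real n) / L)"
      using h_eps_max_le[OF metric d p L \<epsilon>(1) n(1,2)] by (simp only: radius)
    also have "\<dots> \<le> h_eps G M \<alpha> d \<sigma> (ereal p) \<epsilon> \<rho> + ereal (a * ln (1 / \<epsilon>))"
      using ln_bound by (intro add_left_mono) simp
    finally have "h_eps G M \<alpha> d \<sigma> \<infinity> (\<epsilon> powr (1 - a)) \<rho> / ereal (ln (1 / \<epsilon>))
        \<le> (h_eps G M \<alpha> d \<sigma> (ereal p) \<epsilon> \<rho> + ereal (a * ln (1 / \<epsilon>))) / ereal (ln (1 / \<epsilon>))"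
      using pos by (intro ereal_divide_right_mono) auto
    also have "\<dots> = f (ereal p) \<epsilon> + ereal a"
      unfolding f_def using pos
      by (cases "h_eps G M \<alpha> d \<sigma> (ereal p) \<epsilon> \<rho>") (auto simp: add_divide_distrib)
    also have "h_eps G M \<alpha> d \<sigma> \<infinity> (\<epsilon> powr (1 - a)) \<rho> / ereal (ln (1 / \<epsilon>))
        = ereal (1 - a) * f \<infinity> (\<epsilon> powr (1 - a))"
    proof -
      have "ln (1 / \<epsilon> powr (1 - a)) = (1 - a) * ln (1 / \<epsilon>)"
        using \<epsilon>(1) by (simp add: ln_div ln_powr)
      then show ?thesis
        unfolding f_def using pos a
        by (cases "h_eps G M \<alpha> d \<sigma> \<infinity> (\<epsilon> powr (1 - a)) \<rho>") auto
    qed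
    finally show ?case .
  qed
qed

lemma mdim_eq_mdim_max:
  assumes metric: "Metric_space M \<rho>" and d: "\<And>i. 1 \<le> d i"
    and tame: "tame_growth M \<rho>" and p: "1 \<le> p"
  shows "lower_mdim G M \<alpha> d \<sigma> (ereal p) \<rho> = lower_mdim G M \<alpha> d \<sigma> \<infinity> \<rho>"
    and "upper_mdim G M \<alpha> d \<sigma> (ereal p) \<rho> = upper_mdim G M \<alpha> d \<sigma> \<infinity> \<rho>"
proof -
  have "\<forall>\<^sub>F \<epsilon> in at_right (0::real). \<epsilon> \<in> {0<..<1}"
    by (rule eventually_at_right_real) simp
  then have le: "\<forall>\<^sub>F \<epsilon> in at_right 0. h_eps G M \<alpha> d \<sigma> (ereal p) \<epsilon> \<rho> / ereal (ln (1 / \<epsilon>))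
      \<le> h_eps G M \<alpha> d \<sigma> \<infinity> \<epsilon> \<rho> / ereal (ln (1 / \<epsilon>))"
    by (rule eventually_mono)
      (auto intro!: ereal_divide_right_mono h_eps_mono_exponent d p metric)
  note ge = h_eps_max_rescaled_le[OF metric d p tame, where G = G and \<alpha> = \<alpha> and \<sigma> = \<sigma>]
  show "lower_mdim G M \<alpha> d \<sigma> (ereal p) \<rho> = lower_mdim G M \<alpha> d \<sigma> \<infinity> \<rho>"
    unfolding lower_mdim_def
    by (intro antisym Liminf_mono[OF le] Liminf_Limsup_le_of_rescaling(1) ge)
  show "upper_mdim G M \<alpha> d \<sigma> (ereal p) \<rho> = upper_mdim G M \<alpha> d \<sigma> \<infinity> \<rho>"
    unfolding upper_mdim_def
    by (intro antisym Limsup_mono[OF le] Liminf_Limsup_le_of_rescaling(2) ge)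
qed

theorem proposition3p5:
  fixes G :: "('g, 'z) monoid_scheme"
    and X :: "'x topology"
    and \<alpha> :: "'g \<Rightarrow> 'x \<Rightarrow> 'x"
    and d :: "nat \<Rightarrow> nat"
    and \<sigma> :: "nat \<Rightarrow> 'g \<Rightarrow> nat \<Rightarrow> nat"
    and \<rho> :: "'x \<Rightarrow> 'x \<Rightarrow> real"
    and p :: real
  assumes "group G" and "countable (carrier G)" and "sofic_group G"
    and "compact_space X" and "metrizable_space X"
    and "group_action G (topspace X) \<alpha>"
    and "\<And>s. s \<in> carrier G \<Longrightarrow> homeomorphic_map X X (\<alpha> s)"
    and "sofic_approximation G d \<sigma>"
    and "compatible_metric X \<rho>"
    and "tame_growth (topspace X) \<rho>"
    and "1 \<le> p"
  shows "lower_mdim G (topspace X) \<alpha> d \<sigma> 1 \<rho> = lower_mdim G (topspace X) \<alpha> d \<sigma> (ereal p) \<rho> \<and>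
         lower_mdim G (topspace X) \<alpha> d \<sigma> (ereal p) \<rho> = lower_mdim G (topspace X) \<alpha> d \<sigma> \<infinity> \<rho> \<and>
         upper_mdim G (topspace X) \<alpha> d \<sigma> 1 \<rho> = upper_mdim G (topspace X) \<alpha> d \<sigma> (ereal p) \<rho> \<and>
         upper_mdim G (topspace X) \<alpha> d \<sigma> (ereal p) \<rho> = upper_mdim G (topspace X) \<alpha> d \<sigma> \<infinity> \<rho>"
proof -
  have metric: "Metric_space (topspace X) \<rho>"
    using assms(9) by (simp add: compatible_metric_def)
  have d: "1 \<le> d i" for i
    using assms(8) by (simp add: sofic_approximation_def)
  note eq = mdim_eq_mdim_max[OF metric d assms(10), where G = G and \<alpha> = \<alpha> and \<sigma> = \<sigma>]
  show ?thesis
    using eq[of 1] eq[OF assms(11)] by (simp add: one_ereal_def)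
qed

end
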